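(* Let $n\ge 8$, let $U$ be a random matrix distributed according to Haar measure on the unitary group $U(n,\mathbb{C})$, and let $W=|\mathrm{Tr}(U)|^2$. Let $Z$ be an exponential random variable with mean one. Then $$d_K(W,Z)\le \frac{2^{9/4}}{\sqrt{n}}.$$
   Context: $\mathrm{Tr}$ denotes the trace, Haar measure is normalized to be a probability measure, and $d_K(W,Z)=\sup_{t\in\mathbb{R}}|\mathbb{P}(W\le t)-\mathbb{P}(Z\le t)|$ is the Kolmogorov distance. *)

theory Defs
  imports "HOL-Probability.Probability"
begin

definition conj_transpose :: "complex ^ 'n ^ 'm \<Rightarrow> complex ^ 'm ^ 'n" where
  "conj_transpose A = (\<chi> i j. cnj (A $ j $ i))"

definition unitary_group :: "(complex ^ 'n ^ 'n) set" where
  "unitary_group = {A. conj_transpose A ** A = mat 1 \<and> A ** conj_transpose A = mat 1}"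

abbreviation unitary_borel :: "(complex ^ 'n ^ 'n) measure" where
  "unitary_borel \<equiv> restrict_space borel unitary_group"

text \<open>Only left invariance is required. Since the unitary group is compact, this determines the
  probability measure uniquely and implies right invariance.\<close>

definition is_unitary_haar :: "(complex ^ 'n ^ 'n) measure \<Rightarrow> bool" where
  "is_unitary_haar \<mu> \<longleftrightarrow>
     prob_space \<mu> \<and>
     sets \<mu> = sets unitary_borel \<and>
     (\<forall>V \<in> unitary_group. \<forall>S \<in> sets \<mu>. emeasure \<mu> ((\<lambda>A. V ** A) ` S) = emeasure \<mu> S)"

text \<open>The two random variables may live on different probability spaces. For probability measures
  the supremum is over a subset of the unit interval, so the real-valued supremum is the usual one.\<close>

definition kolmogorov_dist ::
    "'a measure \<Rightarrow> ('a \<Rightarrow> real) \<Rightarrow> 'b measure \<Rightarrow> ('b \<Rightarrow> real) \<Rightarrow> real" where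
  "kolmogorov_dist M W N Z =
     (SUP t :: real. \<bar>\<P>(\<omega> in M. W \<omega> \<le> t) - \<P>(\<omega> in N. Z \<omega> \<le> t)\<bar>)"

end

theory Submission
  imports Defs "HOL-Real_Asymp.Real_Asymp"
begin

text \<open>Write \<open>T = Tr U\<close>, \<open>S = Tr (U\<^sup>2)\<close> and \<open>n\<close> for the dimension. Differentiating the left invariance
  of Haar measure, \<open>\<Sum>\<^sub>i\<^sub>j E (D\<^sub>i\<^sub>j F\<^sub>i\<^sub>j) = 0\<close>, where \<open>D\<^sub>i\<^sub>j\<close> is the derivative in the direction of
  \<open>E\<^sub>i\<^sub>j U\<close>. For \<open>F\<^sub>i\<^sub>j = U\<^sub>i\<^sub>j (cnj T) g(W)\<close> this is Stein's equation of the exponential distribution up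
  to a term of order \<open>1/n\<close>:
  \<open>n E ((1 - W) g(W) + W g'(W)) = E (S (cnj T)\<^sup>2 g'(W))\<close>.
  Taking \<open>F\<^sub>i\<^sub>j = (U\<^sup>2)\<^sub>i\<^sub>j (cnj S)\<close> bounds \<open>E |S|\<^sup>2\<close> by 3. If \<open>g\<close> is the difference of the solutions
  of Stein's equation for \<open>max 0 (x - a)\<close> and \<open>max 0 (x - b)\<close> with \<open>0 < a < b\<close>, then \<open>x g'(x)\<close> is at
  most \<open>b - a\<close> in absolute value, so the expectations of the ramp
  \<open>(max 0 (x - a) - max 0 (x - b)) / (b - a)\<close> under \<open>W\<close> and under the exponential distribution differ
  by at most \<open>2/n\<close>, uniformly in \<open>a\<close> and \<open>b\<close>. Letting \<open>b - a\<close> tend to 0 gives the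
  bound \<open>2/n\<close> for the Kolmogorov distance.\<close>

subsection \<open>Unitary matrices and hermitian projections\<close>

lemma conj_transpose_nth [simp]: "conj_transpose A $ i $ j = cnj (A $ j $ i)"
  by (simp add: conj_transpose_def)

lemma conj_transpose_mult: "conj_transpose (A ** B) = conj_transpose B ** conj_transpose A"
  by (simp add: vec_eq_iff matrix_matrix_mult_def mult.commute)

lemma conj_transpose_conj_transpose [simp]: "conj_transpose (conj_transpose A) = A"
  by (simp add: vec_eq_iff)

lemma unitary_group_mult:
  assumes "A \<in> unitary_group" "B \<in> unitary_group"
  shows "A ** B \<in> unitary_group"
proof -
  have "conj_transpose B ** conj_transpose A ** (A ** B) = mat 1"
    using assms by (metis (mono_tags, lifting) mem_Collect_eq matrix_mul_assoc matrix_mul_lid unitary_group_def)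
  moreover have "A ** B ** (conj_transpose B ** conj_transpose A) = mat 1"
    using assms by (metis (mono_tags, lifting) mem_Collect_eq matrix_mul_assoc matrix_mul_rid unitary_group_def)
  ultimately show ?thesis by (simp add: unitary_group_def conj_transpose_mult)
qed

lemma conj_transpose_unitary: "A \<in> unitary_group \<Longrightarrow> conj_transpose A \<in> unitary_group"
  by (simp add: unitary_group_def)

lemma unitary_row_orthonormal:
  fixes A :: "complex ^ 'n ^ 'n"
  assumes "A \<in> unitary_group"
  shows "(\<Sum>k\<in>UNIV. A $ i $ k * cnj (A $ j $ k)) = (if i = j then 1 else 0)"
proof -
  have "(A ** conj_transpose A) $ i $ j = mat 1 $ i $ j"
    using assms by (simp add: unitary_group_def)
  then show ?thesis by (simp add: matrix_matrix_mult_def mat_def)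
qed

text \<open>Rows are unit vectors. The bound feeds both compactness and the trivial estimate
  \<open>CARD('n)\<close> for traces of unitary matrices.\<close>

lemma unitary_entry_norm_le:
  fixes A :: "complex ^ 'n ^ 'n"
  assumes "A \<in> unitary_group"
  shows "cmod (A $ i $ j) \<le> 1"
proof -
  have "complex_of_real (\<Sum>k\<in>UNIV. (cmod (A $ i $ k))\<^sup>2) = 1"
    using unitary_row_orthonormal[OF assms, of i i] by (simp only: of_real_sum complex_norm_square) simp
  then have "(\<Sum>k\<in>UNIV. (cmod (A $ i $ k))\<^sup>2) = 1"
    using of_real_eq_1_iff by blast
  moreover have "(cmod (A $ i $ j))\<^sup>2 \<le> (\<Sum>k\<in>UNIV. (cmod (A $ i $ k))\<^sup>2)"
    by (rule member_le_sum) auto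
  ultimately show ?thesis by (simp add: power_le_one_iff abs_square_le_1)
qed

lemma unitary_trace_norm_le:
  fixes A :: "complex ^ 'n ^ 'n"
  assumes "A \<in> unitary_group"
  shows "cmod (trace A) \<le> CARD('n)"
proof -
  have "cmod (trace A) \<le> (\<Sum>i\<in>UNIV. cmod (A $ i $ i))"
    unfolding trace_def by (rule norm_sum)
  also have "\<dots> \<le> (\<Sum>i\<in>(UNIV::'n set). 1)"
    by (intro sum_mono unitary_entry_norm_le assms)
  finally show ?thesis by simp
qed

text \<open>Closed, since it is cut out by continuous equations, and bounded, since the entries are.
  Compactness makes every continuous function on the group bounded, hence integrable.\<close>

lemma compact_unitary_group: "compact (unitary_group :: (complex ^ 'n ^ 'n) set)"
proof -
  have "norm A \<le> real CARD('n) * real CARD('n)" if "A \<in> unitary_group" for A :: "complex ^ 'n ^ 'n"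
  proof -
    have row: "norm (A $ i) \<le> real CARD('n)" for i
    proof -
      have "norm (A $ i) \<le> (\<Sum>j\<in>UNIV. norm (A $ i $ j))"
        unfolding norm_vec_def[of "A $ i"] by (rule L2_set_le_sum) simp
      also have "\<dots> \<le> (\<Sum>j\<in>(UNIV::'n set). 1)"
        by (intro sum_mono unitary_entry_norm_le that)
      finally show ?thesis by simp
    qed
    have "norm A \<le> (\<Sum>i\<in>UNIV. norm (A $ i))"
      unfolding norm_vec_def[of A] by (rule L2_set_le_sum) simp
    also have "\<dots> \<le> (\<Sum>i\<in>(UNIV::'n set). real CARD('n))"
      by (intro sum_mono row)
    finally show ?thesis by simp
  qed
  then have "bounded (unitary_group :: (complex ^ 'n ^ 'n) set)"
    by (auto simp: bounded_iff)
  moreover have "closed (unitary_group :: (complex ^ 'n ^ 'n) set)"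
    unfolding unitary_group_def conj_transpose_def matrix_matrix_mult_def
    by (intro closed_Collect_conj closed_Collect_eq continuous_intros)
  ultimately show ?thesis by (simp add: compact_eq_bounded_closed)
qed

section \<open>Hermitian projections and the unitary curves they generate\<close>

text \<open>All positive powers of a projection coincide, so the exponential of
  \<open>\<i> t P\<close> collapses to \<open>1 + (cis t - 1) P\<close>. Projections are also
  numerous enough to separate linear functionals on matrices.\<close>

definition hermitian_projection :: "complex ^ 'n ^ 'n \<Rightarrow> bool" where
  "hermitian_projection P \<longleftrightarrow> conj_transpose P = P \<and> P ** P = P"

text \<open>The one-parameter group generated by \<open>\<i> P\<close>, without matrix exponentials.\<close>

definition phase_shift :: "complex ^ 'n ^ 'n \<Rightarrow> real \<Rightarrow> complex ^ 'n ^ 'n" where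
  "phase_shift P t = (\<chi> i j. (if i = j then 1 else 0) + (cis t - 1) * P $ i $ j)"

lemma phase_shift_mult_nth:
  "(phase_shift P t ** A) $ i $ j = A $ i $ j + (cis t - 1) * (\<Sum>k\<in>UNIV. P $ i $ k * A $ k $ j)"
  by (simp add: phase_shift_def matrix_matrix_mult_def distrib_right sum.distrib sum_distrib_left
      mult.assoc if_distrib[of "\<lambda>x. x * _"] cong: if_cong)

text \<open>For z = \<open>cis s\<close> and w = \<open>cis t\<close>, the coefficient of
  \<open>P\<close> in the product is (z - 1) + (w - 1) + (z - 1)(w - 1) = zw - 1.\<close>

lemma phase_shift_add:
  assumes "P ** P = P"
  shows "phase_shift P s ** phase_shift P t = phase_shift P (s + t)"
proof -
  have "(phase_shift P s ** phase_shift P t) $ i $ j = phase_shift P (s + t) $ i $ j" for i j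
  proof -
    have PP: "(\<Sum>k\<in>UNIV. P $ i $ k * P $ k $ j) = P $ i $ j"
      using arg_cong[OF assms, of "\<lambda>A. A $ i $ j"] by (simp add: matrix_matrix_mult_def)
    have "(\<Sum>k\<in>UNIV. P $ i $ k * phase_shift P t $ k $ j)
        = P $ i $ j + (cis t - 1) * (\<Sum>k\<in>UNIV. P $ i $ k * P $ k $ j)"
      by (simp add: phase_shift_def distrib_left sum.distrib sum_distrib_left
          mult.left_commute if_distrib[of "\<lambda>x. _ * x"] cong: if_cong)
    then show ?thesis
      unfolding phase_shift_mult_nth PP
      by (simp add: phase_shift_def cis_mult[symmetric] algebra_simps)
  qed
  then show ?thesis by (simp add: vec_eq_iff)
qed

lemma phase_shift_0 [simp]: "phase_shift P 0 = mat 1"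
  by (simp add: phase_shift_def mat_def vec_eq_iff)

text \<open>Taking adjoints turns \<open>t\<close> into \<open>- t\<close>, which by the group law
  gives the inverse.\<close>

lemma phase_shift_unitary:
  assumes "hermitian_projection P"
  shows "phase_shift P t \<in> unitary_group"
proof -
  have "cnj (P $ i $ j) = P $ j $ i" for i j
    using assms by (metis conj_transpose_nth hermitian_projection_def)
  then have "conj_transpose (phase_shift P t) = phase_shift P (- t)"
    by (auto simp: phase_shift_def vec_eq_iff cis_cnj)
  then show ?thesis
    using assms by (simp add: unitary_group_def hermitian_projection_def phase_shift_add)
qed

text \<open>This is the orthogonal projection onto the line spanned by the unit vector
  \<open>u\<close>.\<close>

lemma hermitian_projection_outer_product:
  fixes u :: "'n::finite \<Rightarrow> complex"
  assumes "(\<Sum>k\<in>UNIV. u k * cnj (u k)) = 1"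
  shows "hermitian_projection (\<chi> k l. u k * cnj (u l))"
proof -
  have "(\<Sum>k\<in>UNIV. u i * cnj (u k) * (u k * cnj (u j))) = u i * cnj (u j)" for i j
  proof -
    have "(\<Sum>k\<in>UNIV. u i * cnj (u k) * (u k * cnj (u j)))
        = (\<Sum>k\<in>UNIV. u k * cnj (u k)) * (u i * cnj (u j))"
      unfolding sum_distrib_right by (rule sum.cong) (simp_all add: mult_ac)
    then show ?thesis by (simp add: assms)
  qed
  then show ?thesis
    by (simp add: hermitian_projection_def vec_eq_iff matrix_matrix_mult_def mult.commute)
qed

text \<open>Polarisation: the sesquilinear form with coefficients \<open>d\<close> vanishes on all
  unit vectors, hence identically. This passes from tangent directions to the single directions
  \<open>E_kl U\<close>.\<close>

lemma hermitian_projections_separate: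
  fixes d :: "'n::finite \<Rightarrow> 'n \<Rightarrow> complex"
  assumes "\<And>P. hermitian_projection P \<Longrightarrow> (\<Sum>k\<in>UNIV. \<Sum>l\<in>UNIV. P $ k $ l * d k l) = 0"
  shows "d i j = 0"
proof -
  have outer: "(\<Sum>k\<in>UNIV. \<Sum>l\<in>UNIV. u k * cnj (u l) * d k l) = 0"
    if "(\<Sum>k\<in>UNIV. u k * cnj (u k)) = 1" for u
    using assms[OF hermitian_projection_outer_product[OF that]] by simp
  have diag: "d i i = 0" for i
  proof -
    \<comment> \<open>The i-th basis vector isolates the diagonal coefficient.\<close>
    define u where "u k = (if k = i then 1 else 0 :: complex)" for k
    have "u k * cnj (u l) * d k l = (if l = i then if k = i then d i i else 0 else 0)" for k l
      by (simp add: u_def)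
    then have "(\<Sum>k\<in>UNIV. \<Sum>l\<in>UNIV. u k * cnj (u l) * d k l) = d i i"
      by simp
    moreover have "u k * cnj (u k) = (if k = i then 1 else 0)" for k
      by (simp add: u_def)
    then have "(\<Sum>k\<in>UNIV. u k * cnj (u k)) = 1" by simp
    ultimately show ?thesis using outer by simp
  qed
  show ?thesis
  proof (cases "i = j")
    case True
    then show ?thesis using diag by simp
  next
    case False
    \<comment> \<open>Tested on the unit vector (e_i + \<beta> e_j) / sqrt 2, with |\<beta>| =
      1.\<close>
    have pol: "\<beta> * d j i + cnj \<beta> * d i j = 0" if "\<beta> * cnj \<beta> = 1" for \<beta>
    proof -
      define s where "s = complex_of_real (1 / sqrt 2)"
      have s: "s * s = 1 / 2" "cnj s = s"
        by (simp_all add: s_def flip: of_real_mult)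
      define u where "u k = s * ((if k = i then 1 else 0) + (if k = j then \<beta> else 0))" for k
      have "u k * cnj (u k) = (if k = i then 1 / 2 else 0) + (if k = j then 1 / 2 else 0)" for k
        using False that s by (auto simp: u_def algebra_simps)
      then have "(\<Sum>k\<in>UNIV. u k * cnj (u k)) = 1"
        by (simp add: sum.distrib)
      then have "(\<Sum>k\<in>UNIV. \<Sum>l\<in>UNIV. u k * cnj (u l) * d k l) = 0"
        by (rule outer)
      moreover have "u k * cnj (u l) * d k l =
          (if l = i then if k = i then d i i / 2 else 0 else 0)
        + (if l = j then if k = j then d j j / 2 else 0 else 0)
        + (if l = i then if k = j then \<beta> * d j i / 2 else 0 else 0)
        + (if l = j then if k = i then cnj \<beta> * d i j / 2 else 0 else 0)" for k l
      proof -
        have "u k * cnj (u l) = (1 / 2) * (((if k = i then 1 else 0) + (if k = j then \<beta> else 0))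
            * ((if l = i then 1 else 0) + (if l = j then cnj \<beta> else 0)))"
          unfolding s(1)[symmetric] using s(2) by (simp add: u_def mult_ac)
        then show ?thesis using False that by (auto simp: algebra_simps)
      qed
      ultimately have "d i i / 2 + d j j / 2 + \<beta> * d j i / 2 + cnj \<beta> * d i j / 2 = 0"
        by (simp add: sum.distrib)
      then show ?thesis by (simp add: diag flip: add_divide_distrib)
    qed
    \<comment> \<open>The phases 1 and \<open>\<i>\<close> give the sum and the difference of the
      two off-diagonal coefficients.\<close>
    have "d j i + d i j = 0" using pol[of 1] by simp
    moreover have "d j i - d i j = 0"
      using pol[of \<i>] by (simp flip: right_diff_distrib)
    ultimately show ?thesis by simp
  qed
qed

subsection \<open>Differentiation along left translations\<close>

text \<open>\<open>D k l\<close> is the derivative of \<open>F\<close> in the direction \<open>E\<^sub>k\<^sub>l U\<close>, where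
  \<open>E\<^sub>k\<^sub>l\<close> is a matrix unit. This direction is not tangent to the unitary group; it lies in the
  complexified tangent space, which is spanned by the velocities \<open>\<i> P U\<close> of the
  curves \<open>phase_shift P t ** U\<close>.\<close>

definition left_deriv ::
    "(complex ^ 'n ^ 'n \<Rightarrow> complex) \<Rightarrow> ('n::finite \<Rightarrow> 'n \<Rightarrow> complex ^ 'n ^ 'n \<Rightarrow> complex) \<Rightarrow> bool" where
  "left_deriv F D \<longleftrightarrow>
     continuous_on unitary_group F \<and> (\<forall>k l. continuous_on unitary_group (D k l)) \<and>
     (\<forall>P U. hermitian_projection P \<longrightarrow> U \<in> unitary_group \<longrightarrow>
        ((\<lambda>t. F (phase_shift P t ** U)) has_vector_derivative
           \<i> * (\<Sum>k\<in>UNIV. \<Sum>l\<in>UNIV. P $ k $ l * D k l U)) (at 0))"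

section \<open>Calculus rules for left derivatives\<close>

lemma left_derivI:
  assumes "continuous_on unitary_group F"
    and "\<And>k l. continuous_on unitary_group (D k l)"
    and "\<And>P U. hermitian_projection P \<Longrightarrow> U \<in> unitary_group \<Longrightarrow>
        ((\<lambda>t. F (phase_shift P t ** U)) has_vector_derivative
           \<i> * (\<Sum>k\<in>UNIV. \<Sum>l\<in>UNIV. P $ k $ l * D k l U)) (at 0)"
  shows "left_deriv F D"
  using assms by (simp add: left_deriv_def)

lemma left_deriv_cong:
  assumes "left_deriv F D" "\<And>U. F U = F' U" "\<And>k l U. D k l U = D' k l U"
  shows "left_deriv F' D'"
  using assms by (metis ext)

lemma left_deriv_const: "left_deriv (\<lambda>U. c) (\<lambda>k l U. 0)"
  by (rule left_derivI) auto

text \<open>The matrix \<open>E_kl U\<close> has row \<open>l\<close> of \<open>U\<close> as its row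
  \<open>k\<close> and zeros elsewhere.\<close>

lemma left_deriv_entry: "left_deriv (\<lambda>U. U $ i $ j) (\<lambda>k l U. if k = i then U $ l $ j else 0)"
proof (rule left_derivI)
  fix P U :: "complex ^ 'a ^ 'a"
  have "((\<lambda>t. cis t) has_vector_derivative \<i>) (at 0)"
    using has_derivative_cis[of "\<lambda>t. t" "\<lambda>t. t" 0 UNIV]
    by (simp add: has_vector_derivative_def scaleR_conv_of_real mult.commute)
  then have "((\<lambda>t. U $ i $ j + (cis t - 1) * (\<Sum>l\<in>UNIV. P $ i $ l * U $ l $ j))
      has_vector_derivative 0 + (\<i> - 0) * (\<Sum>l\<in>UNIV. P $ i $ l * U $ l $ j)) (at 0)"
    by (intro has_vector_derivative_add has_vector_derivative_const has_vector_derivative_mult_left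
        has_vector_derivative_diff)
  moreover have "(\<Sum>k\<in>UNIV. \<Sum>l\<in>UNIV. P $ k $ l * (if k = i then U $ l $ j else 0))
      = (\<Sum>l\<in>UNIV. P $ i $ l * U $ l $ j)"
    by (subst sum.swap) (simp add: if_distrib[of "\<lambda>x. _ * x"] cong: if_cong)
  ultimately show "((\<lambda>t. (phase_shift P t ** U) $ i $ j) has_vector_derivative
      \<i> * (\<Sum>k\<in>UNIV. \<Sum>l\<in>UNIV. P $ k $ l * (if k = i then U $ l $ j else 0))) (at 0)"
    by (simp add: phase_shift_mult_nth)
next
  show "continuous_on unitary_group (\<lambda>U. if k = i then U $ l $ j else 0)" for k l
    by (cases "k = i") (auto intro!: continuous_intros)
qed (intro continuous_intros)

lemma left_deriv_add:
  assumes "left_deriv F D" "left_deriv G E"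
  shows "left_deriv (\<lambda>U. F U + G U) (\<lambda>k l U. D k l U + E k l U)"
proof (rule left_derivI)
  fix P U :: "complex ^ 'a ^ 'a"
  assume PU: "hermitian_projection P" "U \<in> unitary_group"
  have "((\<lambda>t. F (phase_shift P t ** U) + G (phase_shift P t ** U)) has_vector_derivative
           \<i> * (\<Sum>k\<in>UNIV. \<Sum>l\<in>UNIV. P $ k $ l * D k l U)
         + \<i> * (\<Sum>k\<in>UNIV. \<Sum>l\<in>UNIV. P $ k $ l * E k l U)) (at 0)"
    using assms PU by (intro has_vector_derivative_add) (auto simp: left_deriv_def)
  then show "((\<lambda>t. F (phase_shift P t ** U) + G (phase_shift P t ** U)) has_vector_derivative
           \<i> * (\<Sum>k\<in>UNIV. \<Sum>l\<in>UNIV. P $ k $ l * (D k l U + E k l U))) (at 0)"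
    by (simp add: distrib_left sum.distrib)
qed (use assms in \<open>auto simp: left_deriv_def intro!: continuous_intros\<close>)

lemma left_deriv_sum:
  assumes "finite A" "\<And>x. x \<in> A \<Longrightarrow> left_deriv (F x) (D x)"
  shows "left_deriv (\<lambda>U. \<Sum>x\<in>A. F x U) (\<lambda>k l U. \<Sum>x\<in>A. D x k l U)"
  using assms by (induction A rule: finite_induct) (simp_all add: left_deriv_const left_deriv_add)

lemma left_deriv_mult:
  assumes "left_deriv F D" "left_deriv G E"
  shows "left_deriv (\<lambda>U. F U * G U) (\<lambda>k l U. D k l U * G U + F U * E k l U)"
proof (rule left_derivI)
  fix P U :: "complex ^ 'a ^ 'a"
  assume PU: "hermitian_projection P" "U \<in> unitary_group"
  have "((\<lambda>t. F (phase_shift P t ** U) * G (phase_shift P t ** U)) has_vector_derivative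
           F (phase_shift P 0 ** U) * (\<i> * (\<Sum>k\<in>UNIV. \<Sum>l\<in>UNIV. P $ k $ l * E k l U))
         + (\<i> * (\<Sum>k\<in>UNIV. \<Sum>l\<in>UNIV. P $ k $ l * D k l U)) * G (phase_shift P 0 ** U)) (at 0)"
    using assms PU by (intro has_vector_derivative_mult) (auto simp: left_deriv_def)
  moreover have "F U * (\<i> * (\<Sum>k\<in>UNIV. \<Sum>l\<in>UNIV. P $ k $ l * E k l U))
         + (\<i> * (\<Sum>k\<in>UNIV. \<Sum>l\<in>UNIV. P $ k $ l * D k l U)) * G U
      = \<i> * (\<Sum>k\<in>UNIV. \<Sum>l\<in>UNIV. P $ k $ l * (D k l U * G U + F U * E k l U))"
    by (simp add: distrib_left sum.distrib sum_distrib_left sum_distrib_right mult_ac)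
  ultimately show "((\<lambda>t. F (phase_shift P t ** U) * G (phase_shift P t ** U)) has_vector_derivative
           \<i> * (\<Sum>k\<in>UNIV. \<Sum>l\<in>UNIV. P $ k $ l * (D k l U * G U + F U * E k l U))) (at 0)"
    by simp
qed (use assms in \<open>auto simp: left_deriv_def intro!: continuous_intros\<close>)

text \<open>Since \<open>P\<close> is Hermitian, conjugating \<open>\<i> * P $ k $ l\<close> gives
  \<open>- \<i> * P $ l $ k\<close>; hence the sign and the exchanged indices.\<close>

lemma left_deriv_cnj:
  assumes "left_deriv F D"
  shows "left_deriv (\<lambda>U. cnj (F U)) (\<lambda>k l U. - cnj (D l k U))"
proof (rule left_derivI)
  fix P U :: "complex ^ 'a ^ 'a"
  assume PU: "hermitian_projection P" "U \<in> unitary_group"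
  have P: "cnj (P $ k $ l) = P $ l $ k" for k l
    using PU(1) by (metis conj_transpose_nth hermitian_projection_def)
  have "((\<lambda>t. cnj (F (phase_shift P t ** U))) has_vector_derivative
           cnj (\<i> * (\<Sum>k\<in>UNIV. \<Sum>l\<in>UNIV. P $ k $ l * D k l U))) (at 0)"
    using assms PU
    by (intro bounded_linear.has_vector_derivative[OF bounded_linear_cnj]) (auto simp: left_deriv_def)
  moreover have "cnj (\<i> * (\<Sum>k\<in>UNIV. \<Sum>l\<in>UNIV. P $ k $ l * D k l U))
      = \<i> * (\<Sum>k\<in>UNIV. \<Sum>l\<in>UNIV. P $ k $ l * - cnj (D l k U))"
    by (subst sum.swap) (simp add: P sum_negf)
  ultimately show "((\<lambda>t. cnj (F (phase_shift P t ** U))) has_vector_derivative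
           \<i> * (\<Sum>k\<in>UNIV. \<Sum>l\<in>UNIV. P $ k $ l * - cnj (D l k U))) (at 0)"
    by simp
qed (use assms in \<open>auto simp: left_deriv_def intro!: continuous_intros\<close>)

lemma left_deriv_compose_real:
  fixes g g' :: "real \<Rightarrow> real" and w :: "complex ^ 'n ^ 'n \<Rightarrow> real"
  assumes "left_deriv (\<lambda>U. of_real (w U)) D"
    and g: "\<And>x. (g has_real_derivative g' x) (at x)" and g': "continuous_on UNIV g'"
  shows "left_deriv (\<lambda>U. of_real (g (w U))) (\<lambda>k l U. of_real (g' (w U)) * D k l U)"
proof (rule left_derivI)
  fix P U :: "complex ^ 'n ^ 'n"
  assume PU: "hermitian_projection P" "U \<in> unitary_group"
  let ?c = "\<lambda>t. phase_shift P t ** U"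
  let ?d = "\<i> * (\<Sum>k\<in>UNIV. \<Sum>l\<in>UNIV. P $ k $ l * D k l U)"
  have dw: "((\<lambda>t. complex_of_real (w (?c t))) has_vector_derivative ?d) (at 0)"
    using assms(1) PU by (simp add: left_deriv_def)
  from bounded_linear.has_vector_derivative[OF bounded_linear_Re dw]
  have "((\<lambda>t. w (?c t)) has_real_derivative Re ?d) (at 0)"
    by (simp add: has_real_derivative_iff_has_vector_derivative)
  then have re: "((\<lambda>t. w (?c t)) has_vector_derivative Re ?d) (at 0)"
    by (simp only: has_real_derivative_iff_has_vector_derivative)
  have "((\<lambda>t. complex_of_real (w (?c t))) has_vector_derivative of_real (Re ?d)) (at 0)"
    by (rule bounded_linear.has_vector_derivative[OF bounded_linear_of_real re])
  \<comment> \<open>A real-valued function has a real derivative along the curve, by uniqueness of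
    derivatives, so the real chain rule for \<open>g\<close> can be used.\<close>
  then have d: "of_real (Re ?d) = ?d"
    using dw by (rule vector_derivative_unique_at)
  have "((\<lambda>t. g (w (?c t))) has_real_derivative g' (w (?c 0)) * Re ?d) (at 0)"
    by (rule DERIV_chain2[OF g]) (simp only: has_real_derivative_iff_has_vector_derivative re)
  then have "((\<lambda>t. g (w (?c t))) has_vector_derivative g' (w U) * Re ?d) (at 0)"
    by (simp only: has_real_derivative_iff_has_vector_derivative) simp
  then have "((\<lambda>t. complex_of_real (g (w (?c t)))) has_vector_derivative of_real (g' (w U) * Re ?d)) (at 0)"
    by (rule bounded_linear.has_vector_derivative[OF bounded_linear_of_real])
  moreover have "complex_of_real (g' (w U) * Re ?d)
      = \<i> * (\<Sum>k\<in>UNIV. \<Sum>l\<in>UNIV. P $ k $ l * (of_real (g' (w U)) * D k l U))"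
    unfolding of_real_mult d by (simp add: sum_distrib_left mult_ac)
  ultimately show "((\<lambda>t. complex_of_real (g (w (?c t)))) has_vector_derivative
      \<i> * (\<Sum>k\<in>UNIV. \<Sum>l\<in>UNIV. P $ k $ l * (of_real (g' (w U)) * D k l U))) (at 0)"
    by simp
next
  have cw: "continuous_on unitary_group w"
    using continuous_on_Re[of unitary_group "\<lambda>U. of_real (w U)"] assms(1) by (simp add: left_deriv_def)
  have "continuous_on UNIV g"
    using g by (intro continuous_at_imp_continuous_on ballI) (rule DERIV_isCont)
  then show "continuous_on unitary_group (\<lambda>U. complex_of_real (g (w U)))"
    by (intro continuous_on_of_real continuous_on_compose2[OF _ cw]) auto
  show "continuous_on unitary_group (\<lambda>U. of_real (g' (w U)) * D k l U)" for k l
    using assms(1) 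
    by (intro continuous_on_mult continuous_on_of_real continuous_on_compose2[OF g' cw])
      (auto simp: left_deriv_def)
qed

subsection \<open>Integration by parts for Haar measure\<close>

locale unitary_haar = prob_space \<mu> for \<mu> :: "(complex ^ 'n ^ 'n) measure" +
  assumes haar: "is_unitary_haar \<mu>"
begin

lemma sets_haar [measurable_cong]: "sets \<mu> = sets unitary_borel"
  using haar by (simp add: is_unitary_haar_def)

lemma space_haar: "space \<mu> = unitary_group"
  using sets_eq_imp_space_eq[OF sets_haar] by (simp add: space_restrict_space)

lemma continuous_measurable:
  fixes F :: "complex ^ 'n ^ 'n \<Rightarrow> 'c::topological_space"
  assumes "continuous_on unitary_group F"
  shows "F \<in> borel_measurable \<mu>"
  using borel_measurable_continuous_on_restrict[OF assms] measurable_cong_sets[OF sets_haar refl]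
  by blast

lemma continuous_bounded:
  fixes F :: "complex ^ 'n ^ 'n \<Rightarrow> 'c::real_normed_vector"
  assumes "continuous_on unitary_group F"
  obtains B where "0 \<le> B" "\<And>U. U \<in> unitary_group \<Longrightarrow> norm (F U) \<le> B"
proof -
  have "bounded (F ` unitary_group)"
    by (intro compact_imp_bounded compact_continuous_image assms compact_unitary_group)
  then obtain B where "B > 0" "\<forall>x\<in>F ` unitary_group. norm x \<le> B"
    by (auto simp: bounded_pos)
  then show ?thesis by (intro that[of B]) auto
qed

lemma continuous_integrable:
  fixes F :: "complex ^ 'n ^ 'n \<Rightarrow> 'c::{banach, second_countable_topology}"
  assumes "continuous_on unitary_group F"
  shows "integrable \<mu> F"
proof -
  obtain B where "\<And>U. U \<in> unitary_group \<Longrightarrow> norm (F U) \<le> B"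
    using continuous_bounded[OF assms] by blast
  then show ?thesis
    by (intro integrable_const_bound[where B = B] continuous_measurable assms) (auto simp: space_haar)
qed

lemma left_mult_measurable:
  assumes "V \<in> unitary_group"
  shows "(\<lambda>U. V ** U) \<in> measurable \<mu> \<mu>"
proof -
  have "continuous_on unitary_group (\<lambda>U. V ** U)"
    unfolding matrix_matrix_mult_def by (intro continuous_intros)
  then have "(\<lambda>U. V ** U) \<in> borel_measurable \<mu>"
    by (rule continuous_measurable)
  then have "(\<lambda>U. V ** U) \<in> measurable \<mu> unitary_borel"
    using assms by (intro measurable_restrict_space2) (auto simp: space_haar unitary_group_mult)
  then show ?thesis
    using measurable_cong_sets[OF refl sets_haar] by blast
qed

text \<open>Haar invariance is given for images; the preimage of \<open>S\<close> under
  multiplication by \<open>V\<close> is its image under multiplication by the adjoint of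
  \<open>V\<close>.\<close>

lemma distr_left_mult:
  assumes "V \<in> unitary_group"
  shows "distr \<mu> \<mu> (\<lambda>U. V ** U) = \<mu>"
proof (rule measure_eqI)
  fix S assume "S \<in> sets (distr \<mu> \<mu> (\<lambda>U. V ** U))"
  then have S: "S \<in> sets \<mu>" by simp
  let ?V' = "conj_transpose V"
  have V': "?V' \<in> unitary_group" using assms by (rule conj_transpose_unitary)
  have inv: "V ** (?V' ** A) = A" "?V' ** (V ** A) = A" for A
    using assms by (simp_all add: unitary_group_def matrix_mul_assoc)
  have "S \<subseteq> unitary_group" using sets.sets_into_space[OF S] by (simp add: space_haar)
  then have "(\<lambda>A. ?V' ** A) ` S \<subseteq> (\<lambda>U. V ** U) -` S \<inter> space \<mu>"
    using unitary_group_mult[OF V'] by (auto simp: space_haar inv)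
  moreover have "U \<in> (\<lambda>A. ?V' ** A) ` S" if "V ** U \<in> S" for U
    using imageI[OF that, of "\<lambda>A. ?V' ** A"] by (simp only: inv)
  ultimately have "(\<lambda>U. V ** U) -` S \<inter> space \<mu> = (\<lambda>A. ?V' ** A) ` S"
    by blast
  then show "emeasure (distr \<mu> \<mu> (\<lambda>U. V ** U)) S = emeasure \<mu> S"
    using haar V' S left_mult_measurable[OF assms] by (simp add: emeasure_distr is_unitary_haar_def)
qed simp

lemma integral_left_mult:
  fixes F :: "complex ^ 'n ^ 'n \<Rightarrow> 'c::{banach, second_countable_topology}"
  assumes "V \<in> unitary_group" "F \<in> borel_measurable \<mu>"
  shows "(\<integral>U. F (V ** U) \<partial>\<mu>) = (\<integral>U. F U \<partial>\<mu>)"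
  using integral_distr[OF left_mult_measurable[OF assms(1)] assms(2)] distr_left_mult[OF assms(1)]
  by simp

text \<open>By invariance the difference quotients of \<open>F\<close> along
  \<open>phase_shift P t ** U\<close> have integral 0. Dominated convergence passes this to the
  derivative for every \<open>P\<close>, and projections separate the coefficients.\<close>

lemma integral_left_deriv:
  assumes FD: "left_deriv F D"
  shows "(\<integral>U. D i j U \<partial>\<mu>) = 0"
proof (rule hermitian_projections_separate)
  fix P :: "complex ^ 'n ^ 'n"
  assume P: "hermitian_projection P"
  define F' where "F' U = \<i> * (\<Sum>k\<in>UNIV. \<Sum>l\<in>UNIV. P $ k $ l * D k l U)" for U
  have contF: "continuous_on unitary_group F" and contD: "continuous_on unitary_group (D k l)" for k l
    using FD by (auto simp: left_deriv_def)
  have contF': "continuous_on unitary_group F'"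
    unfolding F'_def by (intro continuous_intros contD)
  obtain B where B: "0 \<le> B" "\<And>U. U \<in> unitary_group \<Longrightarrow> norm (F' U) \<le> B"
    using continuous_bounded[OF contF'] by blast
  have shift: "phase_shift P t ** U \<in> unitary_group" if "U \<in> unitary_group" for t U
    using P that by (intro unitary_group_mult phase_shift_unitary)
  \<comment> \<open>\<open>left_deriv\<close> speaks only of time 0; the group law moves the base
    point to any time \<open>s\<close>.\<close>
  have deriv: "((\<lambda>t. F (phase_shift P t ** U)) has_vector_derivative F' (phase_shift P s ** U)) (at s)"
    if U: "U \<in> unitary_group" for U s
  proof -
    have "((\<lambda>t. F (phase_shift P t ** (phase_shift P s ** U))) has_vector_derivative
        F' (phase_shift P s ** U)) (at 0)"
      using FD P shift[OF U] by (simp add: left_deriv_def F'_def)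
    then have "((\<lambda>t. F (phase_shift P (t + s) ** U)) has_vector_derivative
        F' (phase_shift P s ** U)) (at 0)"
      using P by (simp add: matrix_mul_assoc phase_shift_add hermitian_projection_def)
    moreover have "((\<lambda>t. t - s) has_vector_derivative 1) (at s)"
      by (auto intro!: derivative_eq_intros)
    ultimately show ?thesis
      using vector_diff_chain_at[of "\<lambda>t. t - s" 1 s "\<lambda>t. F (phase_shift P (t + s) ** U)"
          "F' (phase_shift P s ** U)"]
      by (simp add: comp_def)
  qed
  define t where "t m = 1 / real (Suc m)" for m
  define q where "q m U = (F (phase_shift P (t m) ** U) - F U) /\<^sub>R t m" for m U
  have t0: "t m > 0" for m by (simp add: t_def)
  have "t \<longlonglongrightarrow> 0"
    unfolding t_def using LIMSEQ_inverse_real_of_nat by (simp add: inverse_eq_divide)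
  then have tat: "filterlim t (at 0) sequentially"
    using t0 by (simp add: filterlim_at less_imp_neq[symmetric])
  have intq: "(\<integral>U. q m U \<partial>\<mu>) = 0" for m
  proof -
    have "continuous_on unitary_group (\<lambda>U. F (phase_shift P (t m) ** U))"
      using shift unfolding matrix_matrix_mult_def
      by (intro continuous_on_compose2[OF contF] continuous_intros) (auto simp: matrix_matrix_mult_def)
    then have "(\<integral>U. q m U \<partial>\<mu>) = ((\<integral>U. F (phase_shift P (t m) ** U) \<partial>\<mu>) - (\<integral>U. F U \<partial>\<mu>)) /\<^sub>R t m"
      unfolding q_def
      by (subst integral_scaleR_right) (auto simp: Bochner_Integration.integral_diff continuous_integrable contF)
    then show ?thesis
      using P contF by (simp add: integral_left_mult phase_shift_unitary continuous_measurable)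
  qed
  have "(\<lambda>m. \<integral>U. q m U \<partial>\<mu>) \<longlonglongrightarrow> (\<integral>U. F' U \<partial>\<mu>)"
  proof (rule integral_dominated_convergence[where w = "\<lambda>_. B"])
    show "F' \<in> borel_measurable \<mu>" by (rule continuous_measurable[OF contF'])
    show "q m \<in> borel_measurable \<mu>" for m
    proof -
      have "continuous_on unitary_group (q m)"
        using shift unfolding q_def matrix_matrix_mult_def
        by (intro continuous_intros continuous_on_compose2[OF contF] contF) (auto simp: matrix_matrix_mult_def)
      then show ?thesis by (rule continuous_measurable)
    qed
    show "AE U in \<mu>. (\<lambda>m. q m U) \<longlonglongrightarrow> F' U"
    proof (rule AE_I2)
      fix U assume "U \<in> space \<mu>"
      then have "((\<lambda>t. F (phase_shift P t ** U)) has_vector_derivative F' (phase_shift P 0 ** U)) (at 0)"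
        by (intro deriv) (simp add: space_haar)
      then have lim: "((\<lambda>t. norm (F (phase_shift P t ** U) - F U - t *\<^sub>R F' U) / norm t) \<longlongrightarrow> 0) (at 0)"
        by (simp add: has_vector_derivative_def has_derivative_at)
      have "((\<lambda>t. (F (phase_shift P t ** U) - F U) /\<^sub>R t - F' U) \<longlongrightarrow> 0) (at 0)"
      proof (rule tendsto_norm_zero_cancel, rule Lim_transform_eventually[OF lim])
        have "(F (phase_shift P t ** U) - F U) /\<^sub>R t - F' U
            = (F (phase_shift P t ** U) - F U - t *\<^sub>R F' U) /\<^sub>R t" if "t \<noteq> 0" for t
          using that by (simp add: scaleR_diff_right)
        then show "\<forall>\<^sub>F t in at 0. norm (F (phase_shift P t ** U) - F U - t *\<^sub>R F' U) / norm t
            = norm ((F (phase_shift P t ** U) - F U) /\<^sub>R t - F' U)"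
          by (simp add: eventually_at_filter divide_inverse mult.commute)
      qed
      then have "((\<lambda>t. (F (phase_shift P t ** U) - F U) /\<^sub>R t) \<longlongrightarrow> F' U) (at 0)"
        by (rule LIM_zero_cancel)
      then show "(\<lambda>m. q m U) \<longlonglongrightarrow> F' U"
        unfolding q_def using tat by (rule filterlim_compose)
    qed
    show "AE U in \<mu>. norm (q m U) \<le> B" for m
    proof (rule AE_I2)
      fix U assume "U \<in> space \<mu>"
      then have U: "U \<in> unitary_group" by (simp add: space_haar)
      \<comment> \<open>The mean value inequality: \<open>B\<close> bounds the velocity along the
        whole curve, hence all difference quotients uniformly in \<open>m\<close> and
        \<open>U\<close>.\<close>
      have "norm (F (phase_shift P (t m) ** U) - F (phase_shift P 0 ** U)) \<le> B * norm (t m - 0)"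
      proof (rule differentiable_bound[of UNIV])
        show "((\<lambda>t. F (phase_shift P t ** U)) has_derivative (\<lambda>h. h *\<^sub>R F' (phase_shift P s ** U))) (at s)" for s
          using deriv[OF U] by (simp add: has_vector_derivative_def)
        show "onorm (\<lambda>h. h *\<^sub>R F' (phase_shift P s ** U)) \<le> B" for s
          using B(2)[OF shift[OF U]] by (intro onorm_le) (simp add: mult.commute[of B] mult_left_mono)
      qed auto
      then show "norm (q m U) \<le> B"
        using t0[of m] by (simp add: q_def divide_simps mult.commute)
    qed
  qed simp
  then have "(\<integral>U. F' U \<partial>\<mu>) = 0"
    using intq by (simp add: LIMSEQ_const_iff)
  moreover have "(\<integral>U. F' U \<partial>\<mu>) = \<i> * (\<Sum>k\<in>UNIV. \<Sum>l\<in>UNIV. P $ k $ l * (\<integral>U. D k l U \<partial>\<mu>))"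
    unfolding F'_def by (simp add: continuous_integrable contD Bochner_Integration.integral_sum)
  ultimately show "(\<Sum>k\<in>UNIV. \<Sum>l\<in>UNIV. P $ k $ l * (\<integral>U. D k l U \<partial>\<mu>)) = 0"
    by simp
qed

end

subsection \<open>Stein identity for the trace\<close>

lemma trace_square: "trace (U ** U) = (\<Sum>i\<in>UNIV. \<Sum>j\<in>UNIV. U $ i $ j * U $ j $ i)"
  by (simp add: trace_def matrix_matrix_mult_def)

text \<open>Squared Frobenius norm: each of the \<open>CARD('n)\<close> rows contributes 1.\<close>

lemma unitary_sum_norm_square:
  fixes U :: "complex ^ 'n ^ 'n"
  assumes "U \<in> unitary_group"
  shows "(\<Sum>i\<in>UNIV. \<Sum>j\<in>UNIV. U $ i $ j * cnj (U $ i $ j)) = of_nat CARD('n)"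
  using unitary_row_orthonormal[OF assms] by simp

lemma continuous_on_trace_square: "continuous_on A (\<lambda>U :: complex ^ 'n ^ 'n. trace (U ** U))"
  unfolding trace_square by (intro continuous_intros)

lemma continuous_on_trace: "continuous_on A (\<lambda>U :: complex ^ 'n ^ 'n. trace U)"
  unfolding trace_def by (intro continuous_intros)

section \<open>Left derivatives of the traces of U and of its square\<close>

lemma left_deriv_trace:
  "left_deriv (trace :: complex ^ 'n ^ 'n \<Rightarrow> complex) (\<lambda>k l U. U $ l $ k)"
proof -
  have "left_deriv (\<lambda>U :: complex ^ 'n ^ 'n. \<Sum>i\<in>UNIV. U $ i $ i)
      (\<lambda>k l U. \<Sum>i\<in>UNIV. if k = i then U $ l $ i else 0)"
    by (intro left_deriv_sum left_deriv_entry) simp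
  then show ?thesis by (rule left_deriv_cong) (simp_all add: trace_def)
qed

text \<open>The product rule applied to \<open>trace U * cnj (trace U)\<close>.\<close>

lemma left_deriv_norm_trace_square:
  "left_deriv (\<lambda>U. of_real ((cmod (trace U))\<^sup>2))
     (\<lambda>k l U. U $ l $ k * cnj (trace U) - trace U * cnj (U $ k $ l))"
  by (rule left_deriv_cong[OF left_deriv_mult[OF left_deriv_trace left_deriv_cnj[OF left_deriv_trace]]])
    (simp_all only: complex_norm_square, simp)

text \<open>The two terms are the entries of (E_kl U) U and of U (E_kl U).\<close>

lemma left_deriv_square_entry:
  fixes i j :: "'n::finite"
  shows "left_deriv (\<lambda>U. (U ** U) $ i $ j)
     (\<lambda>k l U. (if k = i then (U ** U) $ l $ j else 0) + U $ i $ k * U $ l $ j)"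
proof -
  have "left_deriv (\<lambda>U. \<Sum>m\<in>UNIV. U $ i $ m * U $ m $ j)
      (\<lambda>k l U. \<Sum>m\<in>UNIV. (if k = i then U $ l $ m else 0) * U $ m $ j
          + U $ i $ m * (if k = m then U $ l $ j else 0))"
    by (intro left_deriv_sum left_deriv_mult left_deriv_entry) simp
  then show ?thesis
    by (rule left_deriv_cong)
      (simp_all add: matrix_matrix_mult_def sum.distrib if_distrib[of "\<lambda>x. _ * x"] cong: if_cong)
qed

text \<open>Both terms of the derivative of \<open>U ** U\<close> have the same trace, whence the
  factor 2.\<close>

lemma left_deriv_trace_square:
  "left_deriv (\<lambda>U :: complex ^ 'n ^ 'n. trace (U ** U)) (\<lambda>k l U. 2 * (U ** U) $ l $ k)"
proof -
  have "left_deriv (\<lambda>U :: complex ^ 'n ^ 'n. \<Sum>i\<in>UNIV. (U ** U) $ i $ i)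
      (\<lambda>k l U. \<Sum>i\<in>UNIV. (if k = i then (U ** U) $ l $ i else 0) + U $ i $ k * U $ l $ i)"
    by (intro left_deriv_sum left_deriv_square_entry) simp
  then show ?thesis
    by (rule left_deriv_cong)
      (simp_all add: trace_def sum.distrib, simp add: matrix_matrix_mult_def mult.commute)
qed

context unitary_haar
begin

text \<open>A divergence theorem for matrix-valued fields. \<open>H\<close> is a simplified form of
  the divergence, which may use that \<open>U\<close> is unitary.\<close>

lemma integral_sum_left_deriv:
  assumes "\<And>i j. left_deriv (F i j) (D i j)"
    and "\<And>U. U \<in> unitary_group \<Longrightarrow> (\<Sum>i\<in>UNIV. \<Sum>j\<in>UNIV. D i j i j U) = H U"
  shows "(\<integral>U. H U \<partial>\<mu>) = 0"
proof -
  have "integrable \<mu> (D i j k l)" for i j k l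
    using assms(1)[of i j] by (intro continuous_integrable) (auto simp: left_deriv_def)
  then have "(\<integral>U. (\<Sum>i\<in>UNIV. \<Sum>j\<in>UNIV. D i j i j U) \<partial>\<mu>) = 0"
    by (simp add: Bochner_Integration.integral_sum integral_left_deriv[OF assms(1)])
  moreover have "(\<integral>U. (\<Sum>i\<in>UNIV. \<Sum>j\<in>UNIV. D i j i j U) \<partial>\<mu>) = (\<integral>U. H U \<partial>\<mu>)"
    by (intro Bochner_Integration.integral_cong) (simp_all add: assms(2) space_haar)
  ultimately show ?thesis by simp
qed

text \<open>The field \<open>U $ i $ j * cnj T * g W\<close> has divergence n W g - n (g + W g') + S
  (cnj T)^2 g'. The first term comes from differentiating \<open>U $ i $ j\<close>; the factor n in
  the second is the Frobenius norm.\<close>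

lemma stein_identity:
  fixes g g' :: "real \<Rightarrow> real"
  defines "W \<equiv> \<lambda>U :: complex ^ 'n ^ 'n. (cmod (trace U))\<^sup>2"
  assumes g: "\<And>x. (g has_real_derivative g' x) (at x)" and g': "continuous_on UNIV g'"
  shows "of_nat CARD('n) * (\<integral>U. of_real ((1 - W U) * g (W U) + W U * g' (W U)) \<partial>\<mu>)
    = (\<integral>U. trace (U ** U) * (cnj (trace U))\<^sup>2 * of_real (g' (W U)) \<partial>\<mu>)"
proof -
  have cW: "continuous_on A W" for A
    unfolding W_def by (intro continuous_intros continuous_on_trace)
  have cg: "continuous_on UNIV g"
    using g by (intro continuous_at_imp_continuous_on ballI) (rule DERIV_isCont)
  note c = continuous_on_compose2[OF g' cW subset_UNIV] continuous_on_compose2[OF cg cW subset_UNIV]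
  define L where "L U = of_nat CARD('n) * complex_of_real ((1 - W U) * g (W U) + W U * g' (W U))" for U
  define R where "R U = trace (U ** U) * (cnj (trace U))\<^sup>2 * complex_of_real (g' (W U))" for U :: "complex ^ 'n ^ 'n"
  have "(\<integral>U. R U - L U \<partial>\<mu>) = 0"
  proof (rule integral_sum_left_deriv)
    fix i j :: 'n
    show "left_deriv (\<lambda>U. U $ i $ j * (cnj (trace U) * of_real (g (W U))))
       (\<lambda>k l U. (if k = i then U $ l $ j else 0) * (cnj (trace U) * of_real (g (W U)))
          + U $ i $ j * (- cnj (U $ k $ l) * of_real (g (W U))
          + cnj (trace U) * (of_real (g' (W U)) * (U $ l $ k * cnj (trace U) - trace U * cnj (U $ k $ l)))))"
      unfolding W_def
      by (intro left_deriv_mult left_deriv_entry left_deriv_compose_real g g'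
          left_deriv_norm_trace_square left_deriv_cnj[OF left_deriv_trace])
  next
    fix U :: "complex ^ 'n ^ 'n"
    assume U: "U \<in> unitary_group"
    let ?t = "trace U" and ?g = "complex_of_real (g (W U))" and ?g' = "complex_of_real (g' (W U))"
    have W: "complex_of_real (W U) = ?t * cnj ?t"
      unfolding W_def by (rule complex_norm_square)
    have "(\<Sum>i\<in>UNIV. \<Sum>j\<in>UNIV. (if i = i then U $ j $ j else 0) * (cnj ?t * ?g)
          + U $ i $ j * (- cnj (U $ i $ j) * ?g
          + cnj ?t * (?g' * (U $ j $ i * cnj ?t - ?t * cnj (U $ i $ j)))))
      = (\<Sum>i\<in>(UNIV::'n set). \<Sum>j\<in>UNIV. U $ j $ j * (cnj ?t * ?g))
        - (\<Sum>i\<in>UNIV. \<Sum>j\<in>UNIV. U $ i $ j * cnj (U $ i $ j) * (?g + cnj ?t * ?g' * ?t))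
        + (\<Sum>i\<in>UNIV. \<Sum>j\<in>UNIV. U $ i $ j * U $ j $ i * ((cnj ?t)\<^sup>2 * ?g'))"
      unfolding sum.distrib[symmetric] sum_subtractf[symmetric]
      by (intro sum.cong refl) (simp add: algebra_simps power2_eq_square)
    also have "(\<Sum>i\<in>(UNIV::'n set). \<Sum>j\<in>UNIV. U $ j $ j * (cnj ?t * ?g)) = of_nat CARD('n) * (?t * (cnj ?t * ?g))"
      by (simp add: trace_def flip: sum_distrib_right)
    also have "(\<Sum>i\<in>UNIV. \<Sum>j\<in>UNIV. U $ i $ j * cnj (U $ i $ j) * (?g + cnj ?t * ?g' * ?t))
        = of_nat CARD('n) * (?g + cnj ?t * ?g' * ?t)"
      unfolding sum_distrib_right[symmetric] unitary_sum_norm_square[OF U] ..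
    also have "(\<Sum>i\<in>UNIV. \<Sum>j\<in>UNIV. U $ i $ j * U $ j $ i * ((cnj ?t)\<^sup>2 * ?g'))
        = trace (U ** U) * ((cnj ?t)\<^sup>2 * ?g')"
      unfolding sum_distrib_right[symmetric] trace_square ..
    finally show "(\<Sum>i\<in>UNIV. \<Sum>j\<in>UNIV. (if i = i then U $ j $ j else 0) * (cnj ?t * ?g)
          + U $ i $ j * (- cnj (U $ i $ j) * ?g
          + cnj ?t * (?g' * (U $ j $ i * cnj ?t - ?t * cnj (U $ i $ j))))) = R U - L U"
      by (simp add: L_def R_def W algebra_simps)
  qed
  moreover have "integrable \<mu> R" "integrable \<mu> L"
    unfolding R_def L_def
    by (intro continuous_integrable continuous_intros continuous_on_trace continuous_on_trace_square c cW)+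
  ultimately have "(\<integral>U. L U \<partial>\<mu>) = (\<integral>U. R U \<partial>\<mu>)"
    by simp
  then show ?thesis unfolding L_def R_def by simp
qed

section \<open>Moments of the traces of U and of its square\<close>

text \<open>Constant test function g = 1 in the Stein identity.\<close>

lemma integral_norm_trace_square: "(\<integral>U. (cmod (trace U))\<^sup>2 \<partial>\<mu>) = 1"
proof -
  have i: "integrable \<mu> (\<lambda>U. (cmod (trace U))\<^sup>2)"
    by (intro continuous_integrable continuous_intros continuous_on_trace)
  have "(\<integral>U. complex_of_real (1 - (cmod (trace U))\<^sup>2) \<partial>\<mu>) = 0"
    using stein_identity[of "\<lambda>x. 1" "\<lambda>x. 0"] by simp
  then have "(\<integral>U. 1 - (cmod (trace U))\<^sup>2 \<partial>\<mu>) = 0"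
    by (simp only: integral_complex_of_real of_real_eq_0_iff)
  then show ?thesis using i by (simp add: prob_space)
qed

text \<open>The divergence of \<open>(U ** U) $ i $ j * cnj S\<close> is n |S|^2 + T^2 cnj S - 2 n;
  the last term uses that \<open>U ** U\<close> is unitary.\<close>

lemma integral_trace_square_identity:
  "of_nat CARD('n) * (\<integral>U. of_real ((cmod (trace (U ** U)))\<^sup>2) \<partial>\<mu>)
    = 2 * of_nat CARD('n) - (\<integral>U. (trace U)\<^sup>2 * cnj (trace (U ** U)) \<partial>\<mu>)"
proof -
  have "(\<integral>U. of_nat CARD('n) * complex_of_real ((cmod (trace (U ** U)))\<^sup>2)
      + (trace U)\<^sup>2 * cnj (trace (U ** U)) - 2 * of_nat CARD('n) \<partial>\<mu>) = 0"
  proof (rule integral_sum_left_deriv)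
    fix i j :: 'n
    show "left_deriv (\<lambda>U. (U ** U) $ i $ j * cnj (trace (U ** U)))
       (\<lambda>k l U. ((if k = i then (U ** U) $ l $ j else 0) + U $ i $ k * U $ l $ j) * cnj (trace (U ** U))
          + (U ** U) $ i $ j * - cnj (2 * (U ** U) $ k $ l))"
      by (intro left_deriv_mult left_deriv_square_entry left_deriv_cnj[OF left_deriv_trace_square])
  next
    fix U :: "complex ^ 'n ^ 'n"
    assume U: "U \<in> unitary_group"
    let ?S = "trace (U ** U)"
    have "(\<Sum>i\<in>UNIV. \<Sum>j\<in>UNIV. ((if i = i then (U ** U) $ j $ j else 0) + U $ i $ i * U $ j $ j) * cnj ?S
          + (U ** U) $ i $ j * - cnj (2 * (U ** U) $ i $ j))
      = (\<Sum>i\<in>(UNIV::'n set). \<Sum>j\<in>UNIV. (U ** U) $ j $ j * cnj ?S)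
        + (\<Sum>i\<in>UNIV. \<Sum>j\<in>UNIV. U $ i $ i * U $ j $ j * cnj ?S)
        - 2 * (\<Sum>i\<in>UNIV. \<Sum>j\<in>UNIV. (U ** U) $ i $ j * cnj ((U ** U) $ i $ j))"
      unfolding sum.distrib[symmetric] sum_subtractf[symmetric] sum_distrib_left
      by (intro sum.cong refl) (simp add: algebra_simps)
    also have "(\<Sum>i\<in>(UNIV::'n set). \<Sum>j\<in>UNIV. (U ** U) $ j $ j * cnj ?S) = of_nat CARD('n) * (?S * cnj ?S)"
      by (simp add: trace_def flip: sum_distrib_right)
    also have "(\<Sum>i\<in>UNIV. \<Sum>j\<in>UNIV. U $ i $ i * U $ j $ j * cnj ?S) = (trace U)\<^sup>2 * cnj ?S"
      unfolding sum_distrib_right[symmetric] sum_distrib_left[symmetric]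
      by (simp add: trace_def power2_eq_square)
    also have "(\<Sum>i\<in>UNIV. \<Sum>j\<in>UNIV. (U ** U) $ i $ j * cnj ((U ** U) $ i $ j)) = of_nat CARD('n)"
      using U by (intro unitary_sum_norm_square unitary_group_mult)
    finally show "(\<Sum>i\<in>UNIV. \<Sum>j\<in>UNIV. ((if i = i then (U ** U) $ j $ j else 0) + U $ i $ i * U $ j $ j) * cnj ?S
          + (U ** U) $ i $ j * - cnj (2 * (U ** U) $ i $ j))
        = of_nat CARD('n) * complex_of_real ((cmod ?S)\<^sup>2) + (trace U)\<^sup>2 * cnj ?S - 2 * of_nat CARD('n)"
      by (simp only: complex_norm_square)
  qed
  moreover have "integrable \<mu> (\<lambda>U. complex_of_real ((cmod (trace (U ** U)))\<^sup>2))"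
      "integrable \<mu> (\<lambda>U. (trace U)\<^sup>2 * cnj (trace (U ** U)))"
    by (intro continuous_integrable continuous_intros continuous_on_trace continuous_on_trace_square)+
  ultimately show ?thesis
    by (simp del: of_real_power add: prob_space algebra_simps)
qed

text \<open>In the preceding identity the cross term carries no factor n, so the trivial bound |S|
  \<le> n together with E W = 1 already yields E |S|^2 \<le> 3.\<close>

lemma integral_norm_trace_of_square_le: "(\<integral>U. cmod (trace (U ** U)) \<partial>\<mu>) \<le> 2"
proof -
  let ?n = "real CARD('n)"
  have i: "integrable \<mu> (\<lambda>U. (cmod (trace (U ** U)))\<^sup>2)" "integrable \<mu> (\<lambda>U. cmod (trace (U ** U)))"
      "integrable \<mu> (\<lambda>U. (cmod (trace U))\<^sup>2)"
    by (intro continuous_integrable continuous_intros continuous_on_trace continuous_on_trace_square)+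
  have n: "?n > 0" by simp
  have "complex_of_real (?n * (\<integral>U. (cmod (trace (U ** U)))\<^sup>2 \<partial>\<mu>))
      = 2 * of_nat CARD('n) - (\<integral>U. (trace U)\<^sup>2 * cnj (trace (U ** U)) \<partial>\<mu>)"
    using integral_trace_square_identity by (simp only: integral_complex_of_real of_real_mult of_real_of_nat_eq)
  then have "?n * (\<integral>U. (cmod (trace (U ** U)))\<^sup>2 \<partial>\<mu>)
      = 2 * ?n - Re (\<integral>U. (trace U)\<^sup>2 * cnj (trace (U ** U)) \<partial>\<mu>)"
    by (auto dest: arg_cong[of _ _ Re])
  also have "\<dots> \<le> 2 * ?n + cmod (\<integral>U. (trace U)\<^sup>2 * cnj (trace (U ** U)) \<partial>\<mu>)"
    using abs_Re_le_cmod[of "\<integral>U. (trace U)\<^sup>2 * cnj (trace (U ** U)) \<partial>\<mu>"] by linarith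
  also have "cmod (\<integral>U. (trace U)\<^sup>2 * cnj (trace (U ** U)) \<partial>\<mu>)
      \<le> (\<integral>U. cmod ((trace U)\<^sup>2 * cnj (trace (U ** U))) \<partial>\<mu>)"
    by (rule integral_norm_bound)
  also have "\<dots> \<le> (\<integral>U. ?n * (cmod (trace U))\<^sup>2 \<partial>\<mu>)"
  proof (rule integral_mono)
    show "integrable \<mu> (\<lambda>U. cmod ((trace U)\<^sup>2 * cnj (trace (U ** U))))"
      by (intro continuous_integrable continuous_intros continuous_on_trace continuous_on_trace_square)
    fix U assume "U \<in> space \<mu>"
    then have "cmod (trace (U ** U)) \<le> ?n"
      by (intro unitary_trace_norm_le unitary_group_mult) (auto simp: space_haar)
    then show "cmod ((trace U)\<^sup>2 * cnj (trace (U ** U))) \<le> ?n * (cmod (trace U))\<^sup>2"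
      by (simp add: norm_mult norm_power mult.commute[of ?n] mult_left_mono)
  qed (use i in simp)
  also have "\<dots> = ?n" using i by (simp add: integral_norm_trace_square)
  finally have "?n * (\<integral>U. (cmod (trace (U ** U)))\<^sup>2 \<partial>\<mu>) \<le> ?n * 3" by simp
  then have "(\<integral>U. (cmod (trace (U ** U)))\<^sup>2 \<partial>\<mu>) \<le> 3"
    using n by (simp only: mult_le_cancel_left_pos)
  \<comment> \<open>From (|S| - 1)^2 \<ge> 0; the second moment bound 3 gives (3 + 1) / 2 =
    2.\<close>
  moreover have "(\<integral>U. cmod (trace (U ** U)) \<partial>\<mu>) \<le> (\<integral>U. ((cmod (trace (U ** U)))\<^sup>2 + 1) / 2 \<partial>\<mu>)"
  proof (rule integral_mono)
    show "cmod (trace (U ** U)) \<le> ((cmod (trace (U ** U)))\<^sup>2 + 1) / 2" for U :: "complex ^ 'n ^ 'n"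
      using zero_le_power2[of "cmod (trace (U ** U)) - 1"] by (simp add: power2_diff)
  qed (use i in simp_all)
  ultimately show ?thesis using i by (simp add: prob_space)
qed

end

subsection \<open>Stein solutions for the exponential distribution\<close>

text \<open>The removable singularity at 0 is filled in, so that Stein solutions are differentiable
  on the whole line, as \<open>left_deriv_compose_real\<close> asks.\<close>

definition expm1_quotient :: "real \<Rightarrow> real" where
  "expm1_quotient x = (if x = 0 then 1 else (exp x - 1) / x)"

definition expm1_quotient_deriv :: "real \<Rightarrow> real" where
  "expm1_quotient_deriv x = (if x = 0 then 1 / 2 else (exp x * (x - 1) + 1) / x\<^sup>2)"

lemma has_real_derivative_expm1_quotient:
  "(expm1_quotient has_real_derivative expm1_quotient_deriv x) (at x)"
proof (cases "x = 0")
  case True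
  have "((\<lambda>h::real. ((exp h - 1) / h - 1) / h) \<longlongrightarrow> 1 / 2) (at 0)"
    by real_asymp
  then have "((\<lambda>h. (expm1_quotient (0 + h) - expm1_quotient 0) / h) \<longlongrightarrow> 1 / 2) (at 0)"
    by (rule Lim_transform_eventually) (auto simp: eventually_at_filter expm1_quotient_def)
  then show ?thesis
    by (simp add: True DERIV_def expm1_quotient_deriv_def)
next
  case False
  have "((\<lambda>x. (exp x - 1) / x) has_real_derivative expm1_quotient_deriv x) (at x)"
    using False
    by (auto intro!: derivative_eq_intros simp: expm1_quotient_deriv_def field_simps power2_eq_square)
  then show ?thesis
    by (rule has_field_derivative_transform_within_open[where S = "- {0}"])
      (use False in \<open>auto simp: expm1_quotient_def\<close>)
qed

lemma continuous_on_expm1_quotient_deriv: "continuous_on UNIV expm1_quotient_deriv"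
proof (intro continuous_at_imp_continuous_on ballI)
  fix x :: real
  show "isCont expm1_quotient_deriv x"
  proof (cases "x = 0")
    case True
    have "((\<lambda>x::real. (exp x * (x - 1) + 1) / x\<^sup>2) \<longlongrightarrow> 1 / 2) (at 0)"
      by real_asymp
    then have "(expm1_quotient_deriv \<longlongrightarrow> 1 / 2) (at 0)"
      by (rule Lim_transform_eventually) (auto simp: eventually_at_filter expm1_quotient_deriv_def)
    then show ?thesis by (simp add: True isCont_def expm1_quotient_deriv_def)
  next
    case False
    have "continuous_on (- {0}) (\<lambda>x::real. (exp x * (x - 1) + 1) / x\<^sup>2)"
      by (intro continuous_intros) auto
    then have "continuous_on (- {0}) expm1_quotient_deriv"
      by (rule continuous_on_eq) (auto simp: expm1_quotient_deriv_def)
    then show ?thesis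
      by (rule continuous_on_interior) (simp add: False interior_open open_Compl)
  qed
qed

text \<open>\<open>stein_solution a\<close> solves Stein's equation \<open>x g' + (1 - x) g = E k - k\<close> of the exponential
  distribution for \<open>k x = max 0 (x - a)\<close>, where \<open>E k = exp (- a)\<close>.\<close>

definition stein_solution :: "real \<Rightarrow> real \<Rightarrow> real" where
  "stein_solution a x =
     (if x \<in> {..a} then exp (- a) * expm1_quotient x else 1 + (1 - a - exp (- a)) / x)"

text \<open>The condition is written as membership in \<open>{..a}\<close> to fit the rule that
  glues derivatives along closures.\<close>

definition stein_solution_deriv :: "real \<Rightarrow> real \<Rightarrow> real" where
  "stein_solution_deriv a x =
     (if x \<in> {..a} then exp (- a) * expm1_quotient_deriv x else (a - 1 + exp (- a)) / x\<^sup>2)"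

text \<open>Values and slopes of the two branches match at \<open>a\<close>, which makes the
  solution continuously differentiable there.\<close>

lemma stein_solution_connect:
  assumes "a > 0"
  shows "exp (- a) * expm1_quotient a = 1 + (1 - a - exp (- a)) / a"
    and "exp (- a) * expm1_quotient_deriv a = (a - 1 + exp (- a)) / a\<^sup>2"
proof -
  have "exp (- a) * exp a = 1" by (simp flip: exp_add)
  then show "exp (- a) * expm1_quotient a = 1 + (1 - a - exp (- a)) / a"
    "exp (- a) * expm1_quotient_deriv a = (a - 1 + exp (- a)) / a\<^sup>2"
    using assms by (simp_all add: expm1_quotient_def expm1_quotient_deriv_def field_simps)
qed

lemma has_real_derivative_stein_solution:
  assumes "a > 0"
  shows "(stein_solution a has_real_derivative stein_solution_deriv a x) (at x)"
  unfolding has_real_derivative_iff_has_vector_derivative stein_solution_def stein_solution_deriv_def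
proof (rule has_vector_derivative_If_within_closures[where T = "{a<..}"])
  show "((\<lambda>x. exp (- a) * expm1_quotient x) has_vector_derivative exp (- a) * expm1_quotient_deriv x)
      (at x within {..a} \<union> closure {..a} \<inter> closure {a<..})"
    unfolding has_real_derivative_iff_has_vector_derivative[symmetric]
    by (intro DERIV_cmult has_field_derivative_at_within[OF has_real_derivative_expm1_quotient])
  assume "x \<in> {a<..} \<union> closure {..a} \<inter> closure {a<..}"
  \<comment> \<open>The closure of the right branch starts at \<open>a > 0\<close> and so avoids the
    pole at 0.\<close>
  then have "x > 0" using assms by auto
  then have "((\<lambda>x. 1 + (1 - a - exp (- a)) / x) has_real_derivative (a - 1 + exp (- a)) / x\<^sup>2) (at x)"
    by (auto intro!: derivative_eq_intros simp: field_simps power2_eq_square)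
  then show "((\<lambda>x. 1 + (1 - a - exp (- a)) / x) has_vector_derivative (a - 1 + exp (- a)) / x\<^sup>2)
      (at x within {a<..} \<union> closure {..a} \<inter> closure {a<..})"
    unfolding has_real_derivative_iff_has_vector_derivative[symmetric]
    by (rule has_field_derivative_at_within)
next
  assume "x \<in> closure {..a}" "x \<in> closure {a<..}"
  then have "x = a" by simp
  then show "exp (- a) * expm1_quotient x = 1 + (1 - a - exp (- a)) / x"
    "exp (- a) * expm1_quotient_deriv x = (a - 1 + exp (- a)) / x\<^sup>2"
    using stein_solution_connect[OF assms] by simp_all
qed auto

lemma continuous_on_stein_solution_deriv:
  assumes "a > 0"
  shows "continuous_on UNIV (stein_solution_deriv a)"
proof -
  have "continuous_on {x \<in> UNIV. x \<le> a} (\<lambda>x. exp (- a) * expm1_quotient_deriv x)"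
    by (intro continuous_intros continuous_on_subset[OF continuous_on_expm1_quotient_deriv]) auto
  moreover have "continuous_on {x \<in> UNIV. a \<le> x} (\<lambda>x. (a - 1 + exp (- a)) / x\<^sup>2)"
    using assms by (intro continuous_intros) auto
  ultimately have "continuous_on UNIV
      (\<lambda>x. if x \<le> a then exp (- a) * expm1_quotient_deriv x else (a - 1 + exp (- a)) / x\<^sup>2)"
    using stein_solution_connect(2)[OF assms] by (intro continuous_on_cases_le continuous_on_id) auto
  then show ?thesis by (simp add: stein_solution_deriv_def[abs_def])
qed

text \<open>The left side is (x g)' - x g. Here x g is \<open>exp (- a) * (exp x - 1)\<close> up to
  \<open>a\<close>, and x plus a constant beyond.\<close>

lemma stein_equation:
  assumes "a > 0" "x \<ge> 0"
  shows "(1 - x) * stein_solution a x + x * stein_solution_deriv a x = exp (- a) - max 0 (x - a)"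
proof (cases "x \<le> a")
  case True
  have "(1 - x) * expm1_quotient x + x * expm1_quotient_deriv x = 1"
    by (simp add: expm1_quotient_def expm1_quotient_deriv_def field_simps power2_eq_square)
  then have "exp (- a) * ((1 - x) * expm1_quotient x + x * expm1_quotient_deriv x) = exp (- a)"
    by simp
  then show ?thesis
    using True by (simp add: stein_solution_def stein_solution_deriv_def algebra_simps)
next
  case False
  then have "x > 0" using assms by simp
  then show ?thesis
    using False by (simp add: stein_solution_def stein_solution_deriv_def field_simps power2_eq_square)
qed

text \<open>Both follow from 1 + y \<le> \<open>exp y\<close>, at y = a - b and at y = b -
  a.\<close>

lemma exp_minus_diff_bounds:
  fixes a b :: real
  assumes "a \<le> b"
  shows "exp (- a) - exp (- b) \<le> (b - a) * exp (- a)" "(b - a) * exp (- b) \<le> exp (- a) - exp (- b)"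
proof -
  have "exp (- b) = exp (- a) * exp (a - b)" "exp (- a) = exp (- b) * exp (b - a)"
    by (simp_all flip: exp_add)
  moreover have "exp (- a) * (1 + (a - b)) \<le> exp (- a) * exp (a - b)"
      "exp (- b) * (1 + (b - a)) \<le> exp (- b) * exp (b - a)"
    by (intro mult_left_mono exp_ge_add_one_self; simp)+
  ultimately show "exp (- a) - exp (- b) \<le> (b - a) * exp (- a)"
      "(b - a) * exp (- b) \<le> exp (- a) - exp (- b)"
    by (simp_all add: algebra_simps)
qed

text \<open>Left of \<open>a\<close> both solutions are multiples of one function, right of
  \<open>b\<close> both have the rational form, and between them \<open>x\<close> itself serves as
  an intermediate parameter. The factor b - a lets it cancel against the width of a ramp.\<close>

lemma stein_solution_deriv_diff_le:
  assumes ab: "0 < a" "a \<le> b" and x: "x \<ge> 0"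
  shows "\<bar>x * (stein_solution_deriv a x - stein_solution_deriv b x)\<bar> \<le> b - a"
proof -
  \<comment> \<open>The parameters are quantified afresh in \<open>low\<close> and
    \<open>high\<close>, so that \<open>x\<close> can later replace one of them.\<close>
  have low: "\<bar>x * (stein_solution_deriv a x - stein_solution_deriv b x)\<bar> \<le> b - a"
    if "0 < a" "a \<le> b" "x \<le> a" for a b
  proof -
    have q: "0 \<le> x * expm1_quotient_deriv x" "x * expm1_quotient_deriv x \<le> exp x"
    proof -
      have "exp x * (1 - x) \<le> exp x * exp (- x)"
        using exp_ge_add_one_self[of "- x"] by (intro mult_left_mono) auto
      then have "0 \<le> exp x * (x - 1) + 1"
        by (simp add: algebra_simps flip: exp_add)
      then show "0 \<le> x * expm1_quotient_deriv x"
        using x by (simp add: expm1_quotient_deriv_def)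
      show "x * expm1_quotient_deriv x \<le> exp x"
        using x by (simp add: expm1_quotient_deriv_def power2_eq_square field_simps)
    qed
    have e: "0 \<le> exp (- a) - exp (- b)" "exp (- a) - exp (- b) \<le> (b - a) * exp (- a)"
      using that exp_minus_diff_bounds[of a b] by simp_all
    have "\<bar>x * (stein_solution_deriv a x - stein_solution_deriv b x)\<bar>
        = (exp (- a) - exp (- b)) * (x * expm1_quotient_deriv x)"
    proof -
      have "x * (stein_solution_deriv a x - stein_solution_deriv b x)
          = (exp (- a) - exp (- b)) * (x * expm1_quotient_deriv x)"
        using that by (simp add: stein_solution_deriv_def algebra_simps)
      then show ?thesis using mult_nonneg_nonneg[OF e(1) q(1)] by (simp only: abs_of_nonneg)
    qed
    also have "\<dots> \<le> ((b - a) * exp (- a)) * exp x"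
      using q e that by (intro mult_mono) auto
    also have "\<dots> = (b - a) * exp (x - a)"
      by (simp flip: exp_add)
    also have "\<dots> \<le> (b - a) * 1"
      using that by (intro mult_left_mono) auto
    finally show ?thesis by simp
  qed
  have high: "\<bar>x * (stein_solution_deriv a x - stein_solution_deriv b x)\<bar> \<le> b - a"
    if "0 < a" "a \<le> b" "b \<le> x" for a b
  proof -
    \<comment> \<open>At c = x the definition selects the left branch, so the matching of slopes is
      used.\<close>
    have val: "x * stein_solution_deriv c x = (c - 1 + exp (- c)) / x" if "0 < c" "c \<le> x" for c
    proof (cases "c = x")
      case True
      then show ?thesis
        using that stein_solution_connect(2)[of c] by (simp add: stein_solution_deriv_def power2_eq_square)
    next
      case False
      then show ?thesis
        using that by (simp add: stein_solution_deriv_def power2_eq_square)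
    qed
    have "x * (stein_solution_deriv a x - stein_solution_deriv b x)
        = (a - b + (exp (- a) - exp (- b))) / x"
      using val[of a] val[of b] that by (simp add: right_diff_distrib flip: diff_divide_distrib)
    moreover have "(a - b + (exp (- a) - exp (- b))) \<le> 0"
    proof -
      have "(b - a) * exp (- a) \<le> (b - a) * 1" using that by (intro mult_left_mono) auto
      then show ?thesis using exp_minus_diff_bounds(1)[of a b] that by simp
    qed
    moreover have "b - a - (exp (- a) - exp (- b)) \<le> (b - a) * x"
    proof -
      have "b - a - (exp (- a) - exp (- b)) \<le> (b - a) * (1 - exp (- b))"
        using exp_minus_diff_bounds(2)[of a b] that by (simp add: algebra_simps)
      also have "\<dots> \<le> (b - a) * x"
        using that exp_ge_add_one_self[of "- b"] by (intro mult_left_mono) auto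
      finally show ?thesis .
    qed
    ultimately show ?thesis using that by (simp add: abs_of_nonpos divide_le_eq)
  qed
  consider "x \<le> a" | "b \<le> x" | "a < x" "x < b" by linarith
  then show ?thesis
  proof cases
    case 3
    \<comment> \<open>\<open>high\<close> for the pair a, x and \<open>low\<close> for the pair x,
      b; the bounds add up to b - a.\<close>
    have "\<bar>x * (stein_solution_deriv a x - stein_solution_deriv x x)\<bar> \<le> x - a"
      "\<bar>x * (stein_solution_deriv x x - stein_solution_deriv b x)\<bar> \<le> b - x"
      using 3 ab by (auto intro: high low)
    then show ?thesis by (simp add: right_diff_distrib)
  qed (use ab low high in auto)
qed

subsection \<open>Kolmogorov distance\<close>

context unitary_haar
begin

text \<open>Subtracting the Stein identities for \<open>a\<close> and \<open>b\<close> leaves an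
  error of at most (b - a) E |S| / n, and E |S| \<le> 2.\<close>

lemma expectation_ramp:
  assumes ab: "0 < a" "a \<le> b"
  defines "W \<equiv> \<lambda>U :: complex ^ 'n ^ 'n. (cmod (trace U))\<^sup>2"
  shows "\<bar>(\<integral>U. max 0 (W U - a) - max 0 (W U - b) \<partial>\<mu>) - (exp (- a) - exp (- b))\<bar>
    \<le> (b - a) * (2 / CARD('n))"
proof -
  let ?n = "real CARD('n)"
  have cW: "continuous_on A W" for A
    unfolding W_def by (intro continuous_intros continuous_on_trace)
  have ramp: "integrable \<mu> (\<lambda>U. max 0 (W U - c))" for c
    by (intro continuous_integrable continuous_intros cW)
  define r where "r c U = trace (U ** U) * (cnj (trace U))\<^sup>2 * complex_of_real (stein_solution_deriv c (W U))"
    for c and U :: "complex ^ 'n ^ 'n"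
  have stein: "of_real (?n * (\<integral>U. exp (- c) - max 0 (W U - c) \<partial>\<mu>)) = (\<integral>U. r c U \<partial>\<mu>)" if "c > 0" for c
  proof -
    have "(\<integral>U. r c U \<partial>\<mu>)
        = of_nat CARD('n) * (\<integral>U. of_real ((1 - W U) * stein_solution c (W U) + W U * stein_solution_deriv c (W U)) \<partial>\<mu>)"
      using stein_identity[OF has_real_derivative_stein_solution[OF that] continuous_on_stein_solution_deriv[OF that]]
      by (simp only: r_def W_def)
    moreover have "(1 - W U) * stein_solution c (W U) + W U * stein_solution_deriv c (W U)
        = exp (- c) - max 0 (W U - c)" for U
      using that by (intro stein_equation) (auto simp: W_def)
    ultimately show ?thesis
      by (simp only: integral_complex_of_real of_real_mult of_real_of_nat_eq)
  qed
  have ir: "integrable \<mu> (r c)" if "c > 0" for c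
    unfolding r_def
    by (intro continuous_integrable continuous_intros continuous_on_trace continuous_on_trace_square
        continuous_on_compose2[OF continuous_on_stein_solution_deriv[OF that] cW]) auto
  have iS: "integrable \<mu> (\<lambda>U. cmod (trace (U ** U)))"
    by (intro continuous_integrable continuous_intros continuous_on_trace_square)
  let ?d = "(\<integral>U. max 0 (W U - a) - max 0 (W U - b) \<partial>\<mu>) - (exp (- a) - exp (- b))"
  \<comment> \<open>Taken in the order \<open>b\<close> minus \<open>a\<close>, the difference is
    exactly n times the discrepancy \<open>?d\<close>.\<close>
  have "complex_of_real (?n * (\<integral>U. exp (- b) - max 0 (W U - b) \<partial>\<mu>) - ?n * (\<integral>U. exp (- a) - max 0 (W U - a) \<partial>\<mu>))
      = (\<integral>U. r b U - r a U \<partial>\<mu>)"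
  proof -
    have "0 < b" using ab by simp
    then show ?thesis
      using ab(1) ir by (simp only: of_real_diff stein Bochner_Integration.integral_diff)
  qed
  moreover have "?n * (\<integral>U. exp (- b) - max 0 (W U - b) \<partial>\<mu>) - ?n * (\<integral>U. exp (- a) - max 0 (W U - a) \<partial>\<mu>)
      = ?n * ?d"
    using ramp by (simp add: prob_space algebra_simps)
  ultimately have "complex_of_real (?n * ?d) = (\<integral>U. r b U - r a U \<partial>\<mu>)"
    by (simp only:)
  then have "\<bar>?n * ?d\<bar> = cmod (\<integral>U. r b U - r a U \<partial>\<mu>)"
    by (simp only: norm_of_real[symmetric, where 'a = complex])
  also have "\<dots> \<le> (\<integral>U. cmod (r b U - r a U) \<partial>\<mu>)"
    by (rule integral_norm_bound)
  also have "\<dots> \<le> (\<integral>U. (b - a) * cmod (trace (U ** U)) \<partial>\<mu>)"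
  proof (rule integral_mono)
    fix U :: "complex ^ 'n ^ 'n"
    \<comment> \<open>The modulus of (cnj T)^2 is W, which supplies the factor x in the bound on x
      g'(x).\<close>
    have "r b U - r a U = trace (U ** U) * ((cnj (trace U))\<^sup>2
        * of_real (stein_solution_deriv b (W U) - stein_solution_deriv a (W U)))"
      by (simp add: r_def algebra_simps)
    then have "cmod (r b U - r a U) = cmod (trace (U ** U)) * (W U * \<bar>stein_solution_deriv b (W U) - stein_solution_deriv a (W U)\<bar>)"
      by (simp only: norm_mult norm_power complex_mod_cnj norm_of_real W_def)
    also have "W U * \<bar>stein_solution_deriv b (W U) - stein_solution_deriv a (W U)\<bar>
        = \<bar>W U * (stein_solution_deriv a (W U) - stein_solution_deriv b (W U))\<bar>"
      by (simp add: abs_mult abs_minus_commute W_def)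
    also have "cmod (trace (U ** U)) * \<dots> \<le> cmod (trace (U ** U)) * (b - a)"
      using ab by (intro mult_left_mono stein_solution_deriv_diff_le) (auto simp: W_def)
    finally show "cmod (r b U - r a U) \<le> (b - a) * cmod (trace (U ** U))"
      by (simp add: mult.commute)
  qed (use ab ir iS in simp_all)
  also have "\<dots> \<le> (b - a) * 2"
    unfolding integral_mult_right_zero
    using ab integral_norm_trace_of_square_le by (intro mult_left_mono) auto
  finally have "?n * \<bar>?d\<bar> \<le> (b - a) * 2"
    by (simp only: abs_mult abs_of_nat)
  then have "\<bar>?d\<bar> \<le> (b - a) * 2 / ?n"
    by (intro mult_imp_le_div_pos) (simp, simp only: mult.commute[of _ ?n])
  then show ?thesis by (simp only: times_divide_eq_right)
qed

text \<open>The ramp divided by b - a lies between the indicators of W > b and W > a. Its error is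
  uniform in the width, so the width may shrink to 0 at no cost.\<close>

lemma prob_norm_trace_square_gt:
  fixes t :: real
  assumes "t \<ge> 0"
  shows "\<bar>\<P>(U in \<mu>. t < (cmod (trace U))\<^sup>2) - exp (- t)\<bar> \<le> 2 / CARD('n)"
proof -
  define W where "W U = (cmod (trace U))\<^sup>2" for U :: "complex ^ 'n ^ 'n"
  define K where "K = 2 / real CARD('n)"
  have cW: "continuous_on A W" for A
    unfolding W_def by (intro continuous_intros continuous_on_trace)
  have [measurable]: "W \<in> borel_measurable \<mu>"
    by (intro continuous_measurable cW)
  have ir: "integrable \<mu> (\<lambda>U. max 0 (W U - a) - max 0 (W U - b))" for a b
    by (intro continuous_integrable continuous_intros cW)
  have set: "{U \<in> space \<mu>. c < W U} \<in> sets \<mu>" for c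
    by measurable
  have E: "(\<integral>U. (b - a) * indicator {U \<in> space \<mu>. c < W U} U \<partial>\<mu>) = (b - a) * \<P>(U in \<mu>. c < W U)" for a b c
    by simp
  have ii: "integrable \<mu> (\<lambda>U. (b - a) * indicator {U \<in> space \<mu>. c < W U} U)" for a b c :: real
    by (intro integrable_mult_right integrable_real_indicator set) (simp add: less_top[symmetric])
  have upper: "\<P>(U in \<mu>. b < W U) \<le> exp (- a) + K" if "0 < a" "a < b" for a b
  proof -
    have "(b - a) * \<P>(U in \<mu>. b < W U) \<le> (\<integral>U. max 0 (W U - a) - max 0 (W U - b) \<partial>\<mu>)"
      unfolding E[symmetric] using that by (intro integral_mono ii ir) (auto simp: indicator_def max_def)
    also have "\<dots> \<le> exp (- a) - exp (- b) + (b - a) * K"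
      using expectation_ramp[of a b] that by (simp add: W_def K_def)
    also have "\<dots> \<le> (b - a) * (exp (- a) + K)"
      using exp_minus_diff_bounds(1)[of a b] that by (simp add: distrib_left)
    finally show ?thesis using that by simp
  qed
  have lower: "exp (- b) - K \<le> \<P>(U in \<mu>. a < W U)" if "0 < a" "a < b" for a b
  proof -
    have "(b - a) * (exp (- b) - K) \<le> exp (- a) - exp (- b) - (b - a) * K"
      using exp_minus_diff_bounds(2)[of a b] that by (simp add: right_diff_distrib)
    also have "\<dots> \<le> (\<integral>U. max 0 (W U - a) - max 0 (W U - b) \<partial>\<mu>)"
      using expectation_ramp[of a b] that by (simp add: W_def K_def)
    also have "\<dots> \<le> (b - a) * \<P>(U in \<mu>. a < W U)"
      unfolding E[symmetric] using that by (intro integral_mono ii ir) (auto simp: indicator_def max_def)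
    finally show ?thesis using that by simp
  qed
  have "\<P>(U in \<mu>. t < W U) \<le> exp (- t) + K"
  \<comment> \<open>At 0 there is no room for \<open>0 < a < t\<close>, but the right side is then
    at least 1.\<close>
  proof (cases "t = 0")
    case True
    then show ?thesis by (simp add: K_def add_increasing2)
  next
    case False
    have "((\<lambda>a. exp (- a) + K) \<longlongrightarrow> exp (- t) + K) (at_left t)"
      by (intro tendsto_intros)
    moreover have "\<forall>\<^sub>F a in at_left t. \<P>(U in \<mu>. t < W U) \<le> exp (- a) + K"
      using False assms upper by (intro eventually_at_leftI[of 0]) auto
    ultimately show ?thesis by (rule tendsto_lowerbound) simp
  qed
  moreover have "exp (- t) - K \<le> \<P>(U in \<mu>. t < W U)"
  proof -
    have "exp (- b) - K \<le> \<P>(U in \<mu>. t < W U)" if "t < b" for b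
    proof -
      \<comment> \<open>The midpoint keeps the left end of the ramp positive even for t = 0.\<close>
      have "exp (- b) - K \<le> \<P>(U in \<mu>. (t + b) / 2 < W U)"
        using that assms by (intro lower) auto
      also have "\<dots> \<le> \<P>(U in \<mu>. t < W U)"
        using that by (intro finite_measure_mono) (auto simp: field_simps)
      finally show ?thesis .
    qed
    then have "\<forall>\<^sub>F b in at_right t. exp (- b) - K \<le> \<P>(U in \<mu>. t < W U)"
      by (intro eventually_at_rightI[of t "t + 1"]) auto
    moreover have "((\<lambda>b. exp (- b) - K) \<longlongrightarrow> exp (- t) - K) (at_right t)"
      by (intro tendsto_intros)
    ultimately show ?thesis by (intro tendsto_upperbound[of _ _ "at_right t"]) auto
  qed
  ultimately show ?thesis unfolding W_def K_def by linarith
qed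

end

theorem theorem3p1:
  fixes M :: "'a measure" and U :: "'a \<Rightarrow> complex ^ 'n ^ 'n"
    and N :: "'b measure" and Z :: "'b \<Rightarrow> real"
  assumes "CARD('n) \<ge> 8"
    and "prob_space M"
    and "U \<in> measurable M unitary_borel"
    and "is_unitary_haar (distr M unitary_borel U)"
    and "prob_space N"
    and "distributed N lborel Z (exponential_density 1)"
  shows "kolmogorov_dist M (\<lambda>\<omega>. (cmod (trace (U \<omega>)))\<^sup>2) N Z
           \<le> 2 powr (9 / 4) / sqrt (real CARD('n))"
proof -
  let ?W = "\<lambda>A :: complex ^ 'n ^ 'n. (cmod (trace A))\<^sup>2"
  let ?n = "real CARD('n)"
  interpret M: prob_space M by fact
  interpret N: prob_space N by fact
  \<comment> \<open>The estimates are applied to the law of \<open>U\<close> and pulled back to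
    \<open>M\<close> below.\<close>
  interpret unitary_haar "distr M unitary_borel U"
    using assms(4) by (simp add: unitary_haar_def unitary_haar_axioms_def is_unitary_haar_def)
  note [measurable] = assms(3)
  have Wm: "?W \<in> borel_measurable unitary_borel"
    by (intro borel_measurable_continuous_on_restrict continuous_intros continuous_on_trace)
  then have Wm' [measurable]: "(\<lambda>\<omega>. ?W (U \<omega>)) \<in> borel_measurable M"
    by (rule measurable_compose[OF assms(3)])
  have Zm [measurable]: "Z \<in> borel_measurable N"
    using assms(6) by (simp add: distributed_def)
  have Z0: "\<P>(\<omega> in N. Z \<omega> \<le> t) = 1 - exp (- t)" if "t \<ge> 0" for t
    using N.exponential_distributedD_le[OF assms(6) that] by simp
  have bound: "\<bar>\<P>(\<omega> in M. ?W (U \<omega>) \<le> t) - \<P>(\<omega> in N. Z \<omega> \<le> t)\<bar> \<le> 2 / ?n" for t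
  proof (cases "t \<ge> 0")
    case True
    have "\<P>(A in distr M unitary_borel U. t < ?W A) = \<P>(\<omega> in M. t < ?W (U \<omega>))"
    proof -
      have "{A \<in> space unitary_borel. t < ?W A} \<in> sets unitary_borel"
        using Wm by measurable
      moreover have "U -` {A \<in> space unitary_borel. t < ?W A} \<inter> space M = {\<omega> \<in> space M. t < ?W (U \<omega>)}"
        using measurable_space[OF assms(3)] by auto
      ultimately show ?thesis by (simp add: measure_distr)
    qed
    also have "\<dots> = 1 - \<P>(\<omega> in M. ?W (U \<omega>) \<le> t)"
      using M.prob_neg[of "\<lambda>\<omega>. ?W (U \<omega>) \<le> t"] by (simp add: not_le)
    finally show ?thesis
      using prob_norm_trace_square_gt[OF True] Z0[OF True] by linarith
  next
    case False
    \<comment> \<open>For negative \<open>t\<close> both probabilities vanish; for \<open>Z\<close>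
      by comparison with 0, where the distribution function is 1 - exp 0 = 0.\<close>
    have "\<P>(\<omega> in N. Z \<omega> \<le> t) \<le> \<P>(\<omega> in N. Z \<omega> \<le> 0)"
      using False by (intro N.finite_measure_mono) auto
    then have "\<P>(\<omega> in N. Z \<omega> \<le> t) = 0"
      using Z0[of 0] measure_nonneg[of N "{\<omega> \<in> space N. Z \<omega> \<le> t}"] by simp
    moreover have "\<P>(\<omega> in M. ?W (U \<omega>) \<le> t) = 0"
    proof -
      have "{\<omega> \<in> space M. ?W (U \<omega>) \<le> t} = {}"
        using False by (auto simp: not_le intro: less_le_trans)
      then show ?thesis by (simp only: measure_empty)
    qed
    ultimately show ?thesis by simp
  qed
  have "kolmogorov_dist M (\<lambda>\<omega>. ?W (U \<omega>)) N Z \<le> 2 / ?n"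
    unfolding kolmogorov_dist_def by (intro cSUP_least bound) simp
  \<comment> \<open>The bound 2/n is relaxed to the stated form through sqrt n \<le> n and 2 \<le> 2
    powr (9/4).\<close>
  also have "\<dots> \<le> 2 / sqrt ?n"
  proof -
    have "sqrt ?n \<le> ?n" using assms(1) by (intro real_le_lsqrt self_le_power) auto
    then show ?thesis using assms(1) by (intro divide_left_mono) auto
  qed
  also have "\<dots> \<le> 2 powr (9 / 4) / sqrt ?n"
    using powr_mono[of 1 "9 / 4" "2 :: real"] by (intro divide_right_mono) auto
  finally show ?thesis .
qed

end
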